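(* Let $S$ be a unital ring and $n\geq 2$ an integer. Suppose there exist $v_1,\ldots,v_{n-1}\in U(Z(S))$ such that $$1=v_1+v_2+\cdots+v_{n-1}.$$ Then there exist $A,B\in M_n(S)$ with $[A,B]^n=\mathrm{Id}_n$.
   Context: Rings are associative with identity $1$ and not necessarily commutative. $Z(S)$ is the center of $S$, and $U(T)$ is the group of units of a ring $T$. $M_n(S)$ is the ring of $n\times n$ matrices over $S$, $\mathrm{Id}_n$ its identity, and $[A,B]:=AB-BA$. *)

theory Defs
  imports "Jordan_Normal_Form.Matrix"
begin

text \<open>The ring $S$ is the type \<open>'a\<close>. The sort \<open>{ring, monoid_mult}\<close> stands for an associative
  ring with identity; unlike \<^class>\<open>ring_1\<close> it does not require \<open>0 \<noteq> 1\<close>, so the zero ring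
  is included.\<close>

definition ring_center :: "'a::{ring,monoid_mult} set" where
  "ring_center = {z. \<forall>x. z * x = x * z}"

text \<open>Units of a subring \<open>T\<close>: the inverse is required to lie in \<open>T\<close> as well.\<close>

definition units_of_subring :: "'a::{ring,monoid_mult} set \<Rightarrow> 'a set" where
  "units_of_subring T = {u \<in> T. \<exists>w\<in>T. u * w = 1 \<and> w * u = 1}"

definition mat_commutator :: "'a::{ring,monoid_mult} mat \<Rightarrow> 'a mat \<Rightarrow> 'a mat" where
  "mat_commutator A B = A * B - B * A"

text \<open>The library's \<^const>\<open>pow_mat\<close> needs \<^class>\<open>semiring_1\<close>, hence \<open>0 \<noteq> 1\<close>; where it is
  available, the two powers agree.\<close>

primrec mat_power :: "'a::{ring,monoid_mult} mat \<Rightarrow> nat \<Rightarrow> 'a mat" where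
  "mat_power C 0 = 1\<^sub>m (dim_row C)"
| "mat_power C (Suc k) = mat_power C k * C"

lemma mat_power_eq_pow_mat: "mat_power C k = C ^\<^sub>m k" for C :: "'a::ring_1 mat"
  by (induction k) simp_all

end

theory Submission
  imports Defs
begin

text \<open>If \<open>D\<close> is diagonal with central entries \<open>a\<^sub>0, \<dots>, a\<^sub>n\<^sub>-\<^sub>1\<close>, then \<open>[D, B]\<close> has entries
  \<open>(a\<^sub>i - a\<^sub>j) B\<^sub>i\<^sub>j\<close>, so the permutation matrix of an \<open>n\<close>-cycle, whose \<open>n\<close>-th power is the identity,
  is a commutator as soon as the cyclic differences of the \<open>a\<^sub>i\<close> are units. These differences may be
  prescribed to be any \<open>n\<close> central units with sum zero, here \<open>v\<^sub>1, \<dots>, v\<^sub>n\<^sub>-\<^sub>1, -1\<close>.\<close>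

definition cyclic_shift_mat :: "nat \<Rightarrow> 'a::{ring,monoid_mult} mat" where
  "cyclic_shift_mat n = mat n n (\<lambda>(i, j). if j = Suc i mod n then 1 else 0)"

lemma dim_cyclic_shift_mat [simp]:
  "dim_row (cyclic_shift_mat n) = n" "dim_col (cyclic_shift_mat n) = n"
  by (simp_all add: cyclic_shift_mat_def)

lemma index_cyclic_shift_mat [simp]:
  "i < n \<Longrightarrow> j < n \<Longrightarrow> cyclic_shift_mat n $$ (i, j) = (if j = Suc i mod n then 1 else 0)"
  by (simp add: cyclic_shift_mat_def)

text \<open>Row \<open>i\<close> of the \<open>k\<close>-th power has its single 1 in column
  \<open>(i + k) mod n\<close>; one more factor on the right moves this 1 to the cyclically next
  column.\<close>

lemma mat_power_cyclic_shift:
  "mat_power (cyclic_shift_mat n) k =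
     (mat n n (\<lambda>(i, j). if j = (i + k) mod n then 1 else 0) :: 'a::{ring,monoid_mult} mat)"
proof (induction k)
  case 0
  show ?case by (rule eq_matI) auto
next
  case (Suc k)
  show ?case
  proof (rule eq_matI, goal_cases)
    case (1 i j)
    then have i: "i < n" and j: "j < n" by simp_all
    then have "(mat_power (cyclic_shift_mat n) (Suc k) :: 'a mat) $$ (i, j) =
        (\<Sum>l\<in>{0..<n}. (if l = (i + k) mod n then 1 else 0) * (if j = Suc l mod n then 1 else 0))"
      by (simp add: Suc.IH scalar_prod_def)
    also have "\<dots> = (if j = (i + Suc k) mod n then 1 else 0)"
      using i by (simp add: if_distrib[of "\<lambda>x. x * _"] mod_Suc_eq cong: if_cong)
    finally show ?case using i j by simp
  qed (simp_all add: Suc.IH)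
qed

lemma mat_power_cyclic_shift_self:
  "mat_power (cyclic_shift_mat n) n = (1\<^sub>m n :: 'a::{ring,monoid_mult} mat)"
  unfolding mat_power_cyclic_shift by (rule eq_matI) auto

text \<open>Multiplying by the diagonal matrix on the left scales row \<open>i\<close> by
  \<open>a i\<close>, on the right it scales column \<open>j\<close> by \<open>a j\<close>;
  centrality brings the second factor to the left of the entry.\<close>

lemma mat_commutator_diag:
  fixes B :: "'a::{ring,monoid_mult} mat"
  assumes B: "B \<in> carrier_mat n n" and a: "\<And>i. i < n \<Longrightarrow> a i \<in> ring_center"
  shows "mat_commutator (mat n n (\<lambda>(i, j). if i = j then a i else 0)) B =
    mat n n (\<lambda>(i, j). (a i - a j) * B $$ (i, j))" (is "mat_commutator ?D B = _")
proof (rule eq_matI, goal_cases)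
  case (1 i j)
  then have i: "i < n" and j: "j < n" by simp_all
  have DB: "(?D * B) $$ (i, j) = a i * B $$ (i, j)"
    using i j B by (simp add: scalar_prod_def if_distrib[of "\<lambda>x. x * _"] cong: if_cong)
  have "(B * ?D) $$ (i, j) = B $$ (i, j) * a j"
    using i j B by (simp add: scalar_prod_def if_distrib[of "\<lambda>x. _ * x"] cong: if_cong)
  also have "\<dots> = a j * B $$ (i, j)"
    using a[OF j] by (simp add: ring_center_def)
  finally show ?case
    using DB i j B by (simp add: mat_commutator_def algebra_simps del: index_mult_mat(1))
qed (use B in \<open>simp_all add: mat_commutator_def\<close>)

lemma ring_center_uminus: "x \<in> ring_center \<Longrightarrow> - x \<in> ring_center"
  by (simp add: ring_center_def)

lemma ring_center_sum:
  "(\<And>i. i \<in> I \<Longrightarrow> f i \<in> ring_center) \<Longrightarrow> sum f I \<in> ring_center"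
  by (simp add: ring_center_def sum_distrib_left sum_distrib_right)

theorem theorem3p2:
  fixes v :: "nat \<Rightarrow> 'a::{ring,monoid_mult}" and n :: nat
  assumes "n \<ge> 2"
    and "\<And>i. i \<in> {1..n - 1} \<Longrightarrow> v i \<in> units_of_subring ring_center"
    and "1 = (\<Sum>i = 1..n - 1. v i)"
  shows "\<exists>A \<in> carrier_mat n n. \<exists>B \<in> carrier_mat n n.
           mat_power (mat_commutator A B) n = (1\<^sub>m n :: 'a mat)"
proof -
  \<comment> \<open>Negated partial sums telescope: \<open>a i - a (Suc i) = v (Suc i)\<close>,
    starting from the empty sum \<open>a 0 = 0\<close>.\<close>
  define a where "a i = - (\<Sum>k = 1..i. v k)" for i
  have a_center: "a i \<in> ring_center" if "i < n" for i
    unfolding a_def using assms(2) that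
    by (intro ring_center_uminus ring_center_sum) (auto simp: units_of_subring_def)
  have "\<exists>w. (a i - a (Suc i mod n)) * w = 1" if "i < n" for i
  proof (cases "Suc i = n")
    \<comment> \<open>At the wrap-around the full sum of the \<open>v k\<close> is 1, so the
      difference is \<open>-1\<close>, its own inverse.\<close>
    case True
    then have "a i = - 1" "a (Suc i mod n) = 0"
      using assms(3) by (auto simp: a_def)
    then have "(a i - a (Suc i mod n)) * - 1 = 1" by simp
    then show ?thesis ..
  next
    case False
    then have "a i - a (Suc i mod n) = v (Suc i)" "Suc i \<in> {1..n - 1}"
      using that by (auto simp: a_def)
    then show ?thesis
      using assms(2)[of "Suc i"] by (auto simp: units_of_subring_def)
  qed
  then obtain w where w: "\<And>i. i < n \<Longrightarrow> (a i - a (Suc i mod n)) * w i = 1"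
    by metis
  define A where "A = mat n n (\<lambda>(i, j). if i = j then a i else 0)"
  \<comment> \<open>The cyclic shift with its entries replaced by inverses of the differences, so
    that the commutator with \<open>A\<close> restores every 1.\<close>
  define B where "B = mat n n (\<lambda>(i, j). if j = Suc i mod n then w i else 0)"
  have A: "A \<in> carrier_mat n n" and B: "B \<in> carrier_mat n n"
    by (simp_all add: A_def B_def)
  have "mat_commutator A B = mat n n (\<lambda>(i, j). (a i - a j) * B $$ (i, j))"
    unfolding A_def using B a_center by (rule mat_commutator_diag)
  also have "\<dots> = cyclic_shift_mat n"
    by (rule eq_matI) (auto simp: B_def w)
  finally have "mat_power (mat_commutator A B) n = 1\<^sub>m n"
    by (simp add: mat_power_cyclic_shift_self)
  with A B show ?thesis by blast
qed

end
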